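(* Let $c>0$. For every $c$-expensive mechanism $M$ and every distribution $\mathcal{D}$ over $\mathbb{R}^k_{\ge0}$, there exists a $c$-expensive mechanism $M'$ which is either oddly-priced or evenly-priced and satisfies $\mathrm{Rev}(\mathcal{D},M')\ge \mathrm{Rev}(\mathcal{D},M)/2$.
   Context: Setting: one seller, one additive buyer, $k$ items; the buyer's value vector $\vec v\in\mathbb{R}^k_{\ge0}$ is drawn from a distribution $\mathcal{D}$. A mechanism $M$ is a set of options $(\vec q,p)$ with $\vec q\in[0,1]^k$, $p\in\mathbb{R}$, always containing the null option $(\vec 0,0)$; a buyer with values $\vec v$ selects an option maximizing $\vec v\cdot\vec q-p$ (ties broken arbitrarily; a maximizer is assumed to exist), and $\vec q^M(\vec v),p^M(\vec v)$ denote the allocation and price of the selected option. $\mathrm{Rev}(\mathcal{D},M)=\mathbb{E}_{\vec v\sim\mathcal{D}}[p^M(\vec v)]$. A mechanism is $c$-expensive if every option other than the null option has price at least $c$. A $c$-expensive mechanism is oddly-priced (resp. evenly-priced) if every option other than the null option has price in $[c\cdot2^i,c\cdot 2^{i+1})$ for some odd (resp. even) integer $i$. *)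

theory Defs
  imports "HOL-Probability.Probability"
begin

text \<open>Items are indexed by a finite type 'k (k = CARD('k)). An option is a pair
(allocation vector q, price p). A mechanism is a set of options.\<close>

type_synonym 'k option_t = "(real ^ 'k) \<times> real"

definition nonneg_vec :: "real ^ 'k \<Rightarrow> bool" where
  "nonneg_vec v \<longleftrightarrow> (\<forall>i. 0 \<le> v $ i)"

definition null_option :: "'k::finite option_t" where
  "null_option = (0, 0)"

definition utility :: "real ^ 'k \<Rightarrow> 'k::finite option_t \<Rightarrow> real" where
  "utility v x = v \<bullet> fst x - snd x"

definition is_mechanism :: "'k::finite option_t set \<Rightarrow> bool" where
  "is_mechanism M \<longleftrightarrow>
     null_option \<in> M \<and>
     (\<forall>x\<in>M. \<forall>i. 0 \<le> fst x $ i \<and> fst x $ i \<le> 1) \<and>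
     (\<forall>v. nonneg_vec v \<longrightarrow> (\<exists>x\<in>M. \<forall>y\<in>M. utility v y \<le> utility v x))"

definition valid_selection :: "'k::finite option_t set \<Rightarrow> (real ^ 'k \<Rightarrow> 'k option_t) \<Rightarrow> bool" where
  "valid_selection M sel \<longleftrightarrow>
     (\<forall>v. nonneg_vec v \<longrightarrow> sel v \<in> M \<and> (\<forall>y\<in>M. utility v y \<le> utility v (sel v)))"

text \<open>Revenue = expected price paid (prices are nonnegative in the relevant mechanisms,
so we use the nonnegative integral, which may be infinite).\<close>
definition Rev :: "(real ^ 'k) measure \<Rightarrow> (real ^ 'k \<Rightarrow> 'k::finite option_t) \<Rightarrow> ennreal" where
  "Rev D sel = (\<integral>\<^sup>+ v. ennreal (snd (sel v)) \<partial>D)"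

definition c_expensive :: "real \<Rightarrow> 'k::finite option_t set \<Rightarrow> bool" where
  "c_expensive c M \<longleftrightarrow> (\<forall>x\<in>M. x \<noteq> null_option \<longrightarrow> c \<le> snd x)"

definition oddly_priced :: "real \<Rightarrow> 'k::finite option_t set \<Rightarrow> bool" where
  "oddly_priced c M \<longleftrightarrow> c_expensive c M \<and>
     (\<forall>x\<in>M. x \<noteq> null_option \<longrightarrow>
        (\<exists>i::int. odd i \<and> c * 2 powr (real_of_int i) \<le> snd x \<and> snd x < c * 2 powr (real_of_int (i + 1))))"

definition evenly_priced :: "real \<Rightarrow> 'k::finite option_t set \<Rightarrow> bool" where
  "evenly_priced c M \<longleftrightarrow> c_expensive c M \<and>
     (\<forall>x\<in>M. x \<noteq> null_option \<longrightarrow>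
        (\<exists>i::int. even i \<and> c * 2 powr (real_of_int i) \<le> snd x \<and> snd x < c * 2 powr (real_of_int (i + 1))))"

end

theory Submission
  imports Defs
begin

text \<open>
  Let \<open>u\<close> be the indirect utility of \<open>M\<close>. Offering only the options of \<open>M\<close> with prices of one parity
  keeps every buyer who chose such an option, so one parity retains half of the revenue. Two points
  need care: the restricted menu may have no maximizer, since limits of its options can have price
  \<open>c * 2 ^ (i + 1)\<close>, and the given selection need not be measurable.

  Both are met by the menu of all options with price in a closed set \<open>K\<close> and utility at most \<open>u\<close>
  everywhere, ties being broken towards the highest price. With \<open>K = {c..}\<close> this dominates \<open>M\<close> and has
  a Borel price function \<open>P\<close>. A closed subset \<open>K\<close> of the prices of one parity can be chosen to retain
  any fraction \<open>\<theta> < 1\<close> of their revenue, which suffices unless both parities contribute the same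
  finite positive amount. In that case the even menu gains strictly: options of \<open>M\<close>
  scaled down to price \<open>c\<close> attract no buyer away from a retained option, but make every buyer who used
  to pay an odd price pay at least \<open>c\<close>.
\<close>

section \<open>Optimal options and bounds on the prices a buyer accepts\<close>

definition optimal_option :: "'k::finite option_t set \<Rightarrow> real ^ 'k \<Rightarrow> 'k option_t \<Rightarrow> bool" where
  "optimal_option N v x \<longleftrightarrow> x \<in> N \<and> (\<forall>y\<in>N. utility v y \<le> utility v x)"

lemma utility_null_option [simp]: "utility v null_option = 0"
  by (simp add: utility_def null_option_def)

lemma snd_null_option [simp]: "snd null_option = 0"
  by (simp add: null_option_def)

lemma utility_scaleR: "utility v (r *\<^sub>R x) = r * utility v x"
  by (simp add: utility_def right_diff_distrib)

lemma closed_nonneg_vec: "closed {v :: real ^ 'k. nonneg_vec v}"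
  unfolding nonneg_vec_def by (intro closed_Collect_all closed_Collect_le continuous_intros)

text \<open>By Cauchy-Schwarz the value of an allocation in the unit cube is bounded in terms of
  \<open>norm v\<close>. Together with the null option this confines the search for a maximizer to a
  compact part of a closed menu.\<close>

lemma price_le_of_utility_nonneg:
  fixes v :: "real ^ 'k::finite"
  assumes "fst x \<in> cbox 0 1" "utility v x \<ge> 0"
  shows "snd x \<le> norm v * norm (1 :: real ^ 'k)"
proof -
  have "norm (fst x) \<le> norm (1 :: real ^ 'k)"
    using assms(1) by (intro norm_le_componentwise_cart) (auto simp: mem_box_cart)
  then have "v \<bullet> fst x \<le> norm v * norm (1 :: real ^ 'k)"
    by (meson mult_left_mono norm_cauchy_schwarz norm_ge_zero order_trans)
  then show ?thesis using assms(2) by (simp add: utility_def)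
qed

lemma compact_bounded_price:
  fixes N :: "'k::finite option_t set"
  assumes "closed N" "\<And>x. x \<in> N \<Longrightarrow> fst x \<in> cbox 0 1" "\<And>x. x \<in> N \<Longrightarrow> snd x \<ge> 0"
  shows "compact {x \<in> N. snd x \<le> B}"
proof -
  have "{x \<in> N. snd x \<le> B} = N \<inter> (cbox 0 1 \<times> {0..B})"
    using assms(2,3) by (force simp: mem_Times_iff)
  then show ?thesis
    using assms(1) by (simp add: closed_Int_compact compact_Times)
qed

section \<open>Closed menus and their highest-price selection\<close>

text \<open>Breaking ties in favour of the highest price makes the price upper semicontinuous in the
  values, hence Borel measurable.\<close>
lemma closed_menu_selection:
  fixes N :: "'k::finite option_t set"
  assumes cl: "closed N" and null: "null_option \<in> N"
    and box: "\<And>x. x \<in> N \<Longrightarrow> fst x \<in> cbox 0 1" and pos: "\<And>x. x \<in> N \<Longrightarrow> snd x \<ge> 0"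
  obtains s where "is_mechanism N" "valid_selection N s"
    "\<And>v x. nonneg_vec v \<Longrightarrow> optimal_option N v x \<Longrightarrow> snd x \<le> snd (s v)"
    "\<And>v. snd (s v) \<ge> 0"
    "(\<lambda>v. snd (s v)) \<in> borel_measurable borel"
proof -
  define B where "B v = norm v * norm (1 :: real ^ 'k)" for v :: "real ^ 'k"
  have Bpos: "B v \<ge> 0" for v by (simp add: B_def)
  have price_le: "snd x \<le> B v" if "x \<in> N" "utility v x \<ge> 0" for v x
    using price_le_of_utility_nonneg[of x v] box that by (simp add: B_def)
  have cu: "continuous_on S (utility v)" for v :: "real ^ 'k" and S
    unfolding utility_def by (intro continuous_intros)
  have ex_opt: "\<exists>x. optimal_option N v x" for v
  proof -
    \<comment> \<open>The null option lies in \<open>?C\<close>, so the maximum over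
      \<open>?C\<close> is nonnegative. Every option outside \<open>?C\<close> costs more than
      \<open>B v\<close>, hence has negative utility and cannot compete.\<close>
    let ?C = "{x \<in> N. snd x \<le> B v}"
    have "null_option \<in> ?C" using null Bpos by simp
    then have "?C \<noteq> {}" by blast
    then obtain x where x: "x \<in> ?C" "\<forall>y\<in>?C. utility v y \<le> utility v x"
      using continuous_attains_sup[OF compact_bounded_price[OF cl box pos] _ cu] by blast
    have nn: "utility v x \<ge> 0" using bspec[OF x(2) \<open>null_option \<in> ?C\<close>] by simp
    have "utility v y \<le> utility v x" if "y \<in> N" for y
    proof (cases "utility v y \<ge> 0")
      case True
      then show ?thesis using x(2) price_le that by blast
    qed (use nn in linarith)
    then show ?thesis using x(1) unfolding optimal_option_def by blast
  qed
  have opt_nonneg: "utility v x \<ge> 0" if "optimal_option N v x" for v x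
    using that null unfolding optimal_option_def by (metis utility_null_option)
  have ex_best: "\<exists>x. optimal_option N v x \<and> (\<forall>y. optimal_option N v y \<longrightarrow> snd y \<le> snd x)" for v
  proof -
    let ?O = "{x. optimal_option N v x}"
    obtain x0 where x0: "optimal_option N v x0" using ex_opt by blast
    \<comment> \<open>Optimal options have nonnegative utility, so their prices are at most
      \<open>B v\<close>; being optimal then means reaching the utility of \<open>x0\<close>. This
      makes the set of ties compact, so a highest price is attained.\<close>
    have "?O = {x \<in> N. snd x \<le> B v} \<inter> {x. utility v x \<ge> utility v x0}" (is "_ = ?R")
    proof (intro set_eqI iffI)
      fix x assume "x \<in> ?O"
      then show "x \<in> ?R"
        using x0 price_le opt_nonneg by (simp add: optimal_option_def)
    next
      fix x assume "x \<in> ?R"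
      then show "x \<in> ?O"
        using x0 unfolding optimal_option_def by (auto elim: order_trans[rotated])
    qed
    moreover have "closed {x. utility v x \<ge> utility v x0}"
      by (intro closed_Collect_le cu continuous_intros)
    ultimately have "compact ?O"
      using compact_bounded_price[OF cl box pos] by (simp add: compact_Int_closed)
    moreover have "?O \<noteq> {}" using x0 by blast
    moreover have "continuous_on ?O snd" by (intro continuous_intros)
    ultimately show ?thesis
      using continuous_attains_sup[of ?O snd] by blast
  qed
  have "\<exists>b. \<forall>v. optimal_option N v (b v) \<and> (\<forall>y. optimal_option N v y \<longrightarrow> snd y \<le> snd (b v))"
    using ex_best by (intro choice[OF allI])
  then obtain b where b: "\<And>v. optimal_option N v (b v)"
      "\<And>v y. optimal_option N v y \<Longrightarrow> snd y \<le> snd (b v)" by blast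
  have b_in: "b v \<in> N" for v using b(1) by (simp add: optimal_option_def)
  \<comment> \<open>The null default outside the orthant gives price 0 there, so for t > 0 the
    superlevel sets are exactly the closed sets treated next.\<close>
  define s where "s v = (if nonneg_vec v then b v else null_option)" for v
  \<comment> \<open>Along a convergent sequence of values the chosen prices are bounded, so a
    subsequence of the chosen options converges. Its limit is optimal for the limit values, and
    \<open>b l\<close> costs at least as much.\<close>
  have closed_superlevel: "closed {v. nonneg_vec v \<and> t \<le> snd (b v)}" for t
    unfolding closed_sequential_limits
  proof (intro allI impI, elim conjE)
    fix X l assume X: "\<forall>n. X n \<in> {v. nonneg_vec v \<and> t \<le> snd (b v)}" and lim: "X \<longlonglongrightarrow> l"
    have nnl: "nonneg_vec l"
      using closed_sequentially[OF closed_nonneg_vec _ lim] X by blast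
    obtain C where C: "\<And>n. norm (X n) \<le> C"
      using convergent_imp_Bseq[of X] lim unfolding convergent_def Bseq_def by blast
    define C' where "C' = C * norm (1 :: real ^ 'k)"
    have "b (X n) \<in> {x \<in> N. snd x \<le> C'}" for n
    proof -
      have "snd (b (X n)) \<le> B (X n)" using price_le[OF b_in opt_nonneg[OF b(1)]] .
      also have "\<dots> \<le> C'" unfolding B_def C'_def by (intro mult_right_mono C) simp
      finally show ?thesis using b_in by simp
    qed
    then obtain x r where x: "x \<in> {x \<in> N. snd x \<le> C'}" and r: "strict_mono (r :: nat \<Rightarrow> nat)"
        and bx: "((\<lambda>n. b (X n)) \<circ> r) \<longlonglongrightarrow> x"
      using spec[OF compact_bounded_price[OF cl box pos, unfolded compact_def], of "\<lambda>n. b (X n)"]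
      by blast
    have Xr: "(\<lambda>n. X (r n)) \<longlonglongrightarrow> l"
      using LIMSEQ_subseq_LIMSEQ[OF lim r] by (simp add: o_def)
    have bx': "(\<lambda>n. b (X (r n))) \<longlonglongrightarrow> x" using bx by (simp add: o_def)
    have "utility l y \<le> utility l x" if "y \<in> N" for y
    proof (rule LIMSEQ_le)
      show "(\<lambda>n. utility (X (r n)) y) \<longlonglongrightarrow> utility l y"
        unfolding utility_def by (intro tendsto_intros Xr)
      show "(\<lambda>n. utility (X (r n)) (b (X (r n)))) \<longlonglongrightarrow> utility l x"
        unfolding utility_def by (intro tendsto_intros Xr bx')
      show "\<exists>N. \<forall>n\<ge>N. utility (X (r n)) y \<le> utility (X (r n)) (b (X (r n)))"
        using b(1) that by (simp add: optimal_option_def)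
    qed
    then have "optimal_option N l x" using x by (simp add: optimal_option_def)
    then have "snd x \<le> snd (b l)" by (rule b(2))
    moreover have "t \<le> snd x"
      using LIMSEQ_le_const[OF tendsto_snd[OF bx'], of t] X by simp
    ultimately show "l \<in> {v. nonneg_vec v \<and> t \<le> snd (b v)}" using nnl by simp
  qed
  have "{v. t \<le> snd (s v)} \<in> sets borel" for t
  proof (cases "t \<le> 0")
    case True
    then have "{v. t \<le> snd (s v)} = UNIV"
      using pos[OF b_in] by (auto simp: s_def intro: order_trans)
    then show ?thesis by simp
  next
    case False
    then have "{v. t \<le> snd (s v)} = {v. nonneg_vec v \<and> t \<le> snd (b v)}" by (auto simp: s_def)
    then show ?thesis using closed_superlevel[of t] by simp
  qed
  then have meas: "(\<lambda>v. snd (s v)) \<in> borel_measurable borel"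
    by (simp add: borel_measurable_iff_ge)
  have "is_mechanism N"
    unfolding is_mechanism_def
  proof (intro conjI allI impI ballI)
    show "\<exists>x\<in>N. \<forall>y\<in>N. utility v y \<le> utility v x" for v
      using ex_opt unfolding optimal_option_def by blast
  qed (use null box in \<open>auto simp: mem_box_cart\<close>)
  moreover have "valid_selection N s"
    using b(1) by (simp add: valid_selection_def s_def optimal_option_def)
  ultimately show ?thesis
    using that b(2) meas pos[OF b_in] by (simp add: s_def)
qed

section \<open>The undercut menu and its selections\<close>

text \<open>If \<open>u\<close> is the indirect utility of a mechanism, these are the options that can be added to it
  without making any buyer better off. As \<open>u \<ge> 0\<close>, they are stable under scaling by factors in the
  unit interval.\<close>
definition undercut_menu :: "(real ^ 'k \<Rightarrow> real) \<Rightarrow> real set \<Rightarrow> 'k::finite option_t set" where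
  "undercut_menu u K = insert null_option
     {x. fst x \<in> cbox 0 1 \<and> snd x \<in> K \<and> (\<forall>w. nonneg_vec w \<longrightarrow> utility w x \<le> u w)}"

text \<open>For each fixed buyer the utility is continuous in the option, so every bound by
  \<open>u w\<close> is a closed condition, whatever the regularity of \<open>u\<close>.\<close>

lemma closed_undercut_menu:
  assumes "closed K"
  shows "closed (undercut_menu u K)"
proof -
  have "closed (fst -` cbox 0 (1 :: real ^ 'a) \<inter> snd -` K)"
    by (intro closed_Int closed_vimage assms closed_cbox continuous_intros)
  moreover have "closed {x. \<forall>w. nonneg_vec w \<longrightarrow> utility w x \<le> u w}"
    unfolding utility_def
    by (intro closed_Collect_all closed_Collect_imp closed_Collect_le open_Collect_const
        continuous_intros)
  ultimately have "closed (insert null_option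
      ((fst -` cbox 0 1 \<inter> snd -` K) \<inter> {x. \<forall>w. nonneg_vec w \<longrightarrow> utility w x \<le> u w}))"
    by (rule closed_insert[OF closed_Int])
  moreover have "undercut_menu u K = insert null_option
      ((fst -` cbox 0 1 \<inter> snd -` K) \<inter> {x. \<forall>w. nonneg_vec w \<longrightarrow> utility w x \<le> u w})"
    unfolding undercut_menu_def by auto
  ultimately show ?thesis by simp
qed

lemma undercut_menu_utility_le:
  assumes "x \<in> undercut_menu u K" "nonneg_vec v" "u v \<ge> 0"
  shows "utility v x \<le> u v"
  using assms unfolding undercut_menu_def by auto

lemma undercut_menu_price: "x \<in> undercut_menu u K \<Longrightarrow> x \<noteq> null_option \<Longrightarrow> snd x \<in> K"
  unfolding undercut_menu_def by auto

lemma undercut_menu_change_price_set: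
  "x \<in> undercut_menu u K \<Longrightarrow> snd x \<in> K' \<Longrightarrow> x \<in> undercut_menu u K'"
  unfolding undercut_menu_def by auto

lemma undercut_menu_scale:
  assumes x: "x \<in> undercut_menu u K" and r: "0 \<le> r" "r \<le> 1"
    and u: "\<And>w. nonneg_vec w \<Longrightarrow> u w \<ge> 0" and K: "r * snd x \<in> K'"
  shows "r *\<^sub>R x \<in> undercut_menu u K'"
proof -
  have box: "fst x \<in> cbox 0 1"
    using x unfolding undercut_menu_def by (auto simp: null_option_def mem_box_cart)
  have "r *\<^sub>R fst x \<in> cbox 0 1"
    using box r by (auto simp: mem_box_cart intro: mult_le_one)
  moreover have "utility w (r *\<^sub>R x) \<le> u w" if w: "nonneg_vec w" for w
  proof -
    have "r * utility w x \<le> r * u w"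
      using undercut_menu_utility_le[OF x w u[OF w]] r by (intro mult_left_mono)
    also have "\<dots> \<le> u w" using u[OF w] r by (simp add: mult_left_le_one_le)
    finally show ?thesis by (simp add: utility_scaleR)
  qed
  ultimately show ?thesis using K unfolding undercut_menu_def by simp
qed

lemma undercut_menu_selection:
  fixes u :: "real ^ 'k::finite \<Rightarrow> real"
  assumes "closed K" "K \<subseteq> {c..}" "c > 0"
  obtains s where "is_mechanism (undercut_menu u K)" "c_expensive c (undercut_menu u K)"
    "valid_selection (undercut_menu u K) s"
    "\<And>v x. nonneg_vec v \<Longrightarrow> optimal_option (undercut_menu u K) v x \<Longrightarrow> snd x \<le> snd (s v)"
    "\<And>v. snd (s v) \<ge> 0"
    "(\<lambda>v. snd (s v)) \<in> borel_measurable borel"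
proof -
  have "c_expensive c (undercut_menu u K)"
    using undercut_menu_price assms(2) unfolding c_expensive_def by fastforce
  moreover have "null_option \<in> undercut_menu u K" by (simp add: undercut_menu_def)
  moreover have "fst x \<in> cbox 0 1" if "x \<in> undercut_menu u K" for x
    using that by (auto simp: undercut_menu_def null_option_def mem_box_cart)
  moreover have "0 \<le> snd x" if "x \<in> undercut_menu u K" for x
    using that assms(2,3) by (fastforce simp: undercut_menu_def)
  ultimately show thesis
    using closed_menu_selection[OF closed_undercut_menu[OF assms(1)], of u] that by metis
qed

section \<open>Closed cores of unions of half-open intervals\<close>

text \<open>Continuity from below lets a compact initial piece of each interval carry the fraction
  \<theta> of its finite mass. The pieces are locally finite because \<open>a\<close> tends to
  infinity, so their union is closed. Keeping the left endpoints later makes the price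
  \<open>c\<close> available.\<close>

lemma closed_core_of_intervals:
  fixes \<nu> :: "real measure" and a :: "nat \<Rightarrow> real"
  assumes sets: "sets \<nu> = sets borel"
    and a: "strict_mono a" "filterlim a at_top sequentially"
    and fin: "\<And>i. emeasure \<nu> {a i..<a (Suc i)} < \<infinity>"
    and \<theta>: "0 \<le> \<theta>" "\<theta> < 1"
  obtains K where "closed K" "K \<subseteq> (\<Union>i\<in>S. {a i..<a (Suc i)})" "a ` S \<subseteq> K"
    "ennreal \<theta> * emeasure \<nu> (\<Union>i\<in>S. {a i..<a (Suc i)}) \<le> emeasure \<nu> K"
proof -
  define I where "I i = {a i..<a (Suc i)}" for i
  have lt: "a i < a (Suc i)" for i using a(1) by (simp add: strict_mono_Suc_iff)
  have "\<exists>t. a i \<le> t \<and> t < a (Suc i) \<and> ennreal \<theta> * emeasure \<nu> (I i) \<le> emeasure \<nu> {a i..t}" for i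
  proof (cases "emeasure \<nu> (I i) = 0")
    case True
    then show ?thesis using lt by (intro exI[of _ "a i"]) simp
  next
    case False
    define d where "d = a (Suc i) - a i"
    have d: "d > 0" using lt by (simp add: d_def)
    define t where "t n = a (Suc i) - d * inverse (real (Suc n))" for n
    have t: "a i \<le> t n" "t n < a (Suc i)" for n
    proof -
      have "d * inverse (real (Suc n)) \<le> d * 1"
        using d by (intro mult_left_mono) (auto simp: inverse_le_1_iff)
      then show "a i \<le> t n" by (simp add: t_def d_def)
      show "t n < a (Suc i)" using d by (simp add: t_def)
    qed
    have un: "(\<Union>n. {a i..t n}) = I i"
    proof (intro set_eqI iffI)
      fix x assume "x \<in> I i"
      then have x: "a i \<le> x" "x < a (Suc i)" by (auto simp: I_def)
      then obtain n where n: "inverse (real (Suc n)) < (a (Suc i) - x) / d"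
        using reals_Archimedean[of "(a (Suc i) - x) / d"] d by auto
      then have "x \<le> t n" using d by (simp add: t_def pos_less_divide_eq mult.commute)
      then show "x \<in> (\<Union>n. {a i..t n})" using x by auto
    next
      fix x assume "x \<in> (\<Union>n. {a i..t n})"
      then show "x \<in> I i" using t(2) by (fastforce simp: I_def intro: le_less_trans)
    qed
    have "incseq (\<lambda>n. {a i..t n})"
    proof (rule incseq_SucI)
      fix n
      have "t n \<le> t (Suc n)"
        unfolding t_def using d by (intro diff_left_mono mult_left_mono le_imp_inverse_le) auto
      then show "{a i..t n} \<subseteq> {a i..t (Suc n)}" by auto
    qed
    then have sup: "(SUP n. emeasure \<nu> {a i..t n}) = emeasure \<nu> (I i)"
      using SUP_emeasure_incseq[of "\<lambda>n. {a i..t n}" \<nu>] sets un by (simp add: image_subset_iff)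
    \<comment> \<open>Strict because the mass of \<open>I i\<close> is positive and finite and
      \<theta> < 1; hence some member of the increasing sequence already exceeds the left
      side.\<close>
    have "ennreal \<theta> * emeasure \<nu> (I i) < 1 * emeasure \<nu> (I i)"
      using \<theta> False fin[of i] ennreal_mult_strict_right_mono[of "ennreal \<theta>" 1 "emeasure \<nu> (I i)"]
      by (auto simp: I_def zero_less_iff_neq_zero)
    then obtain n where "ennreal \<theta> * emeasure \<nu> (I i) < emeasure \<nu> {a i..t n}"
      using sup less_SUP_iff[of _ "\<lambda>n. emeasure \<nu> {a i..t n}" UNIV] by auto
    then show ?thesis using t by (intro exI[of _ "t n"]) simp
  qed
  then obtain t where t: "\<And>i. a i \<le> t i" "\<And>i. t i < a (Suc i)"
      "\<And>i. ennreal \<theta> * emeasure \<nu> (I i) \<le> emeasure \<nu> {a i..t i}" by metis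
  define J where "J i = {a i..t i}" for i
  have JI: "J i \<subseteq> I i" for i using t(2)[of i] by (auto simp: J_def I_def)
  define K where "K = (\<Union>i\<in>S. J i)"
  have "locally_finite_in euclidean (J ` S)"
    unfolding locally_finite_in_def
  proof (intro conjI ballI)
    fix x :: real
    \<comment> \<open>From index \<open>n\<close> on, all pieces start at or beyond
      \<open>x + 1\<close>, so the neighbourhood \<open>{..<x+1}\<close> of \<open>x\<close> meets
      only finitely many of them.\<close>
    obtain n where n: "\<And>i. i \<ge> n \<Longrightarrow> a i \<ge> x + 1"
      using a(2) by (auto simp: filterlim_at_top eventually_sequentially)
    have "{U \<in> J ` S. U \<inter> {..<x+1} \<noteq> {}} \<subseteq> J ` {..<n}"
    proof
      fix U assume "U \<in> {U \<in> J ` S. U \<inter> {..<x+1} \<noteq> {}}"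
      then obtain i y where i: "U = J i" and y: "y \<in> J i" "y < x + 1" by auto
      from y have "a i < x + 1" by (simp add: J_def)
      then have "i < n" using n[of i] by (meson not_le)
      then show "U \<in> J ` {..<n}" using i by simp
    qed
    then have "finite {U \<in> J ` S. U \<inter> {..<x+1} \<noteq> {}}" by (rule finite_subset) simp
    then show "\<exists>V. openin euclidean V \<and> x \<in> V \<and> finite {U \<in> J ` S. U \<inter> V \<noteq> {}}"
      by (intro exI[of _ "{..<x+1}"]) auto
  qed simp
  then have "closedin euclidean (\<Union>(J ` S))"
    by (rule closedin_locally_finite_Union[rotated]) (auto simp: J_def)
  then have "closed K" by (simp add: K_def)
  have disjI: "disjoint_family I"
  proof -
    have "I i \<inter> I j = {}" if "i < j" for i j
    proof -
      have "a (Suc i) \<le> a j" using a(1) that by (simp add: strict_mono_less_eq Suc_leI)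
      then show ?thesis by (auto simp: I_def)
    qed
    then show ?thesis unfolding disjoint_family_on_def by (metis inf_commute linorder_neqE_nat)
  qed
  \<comment> \<open>Countable additivity in a form that serves both the full intervals
    \<open>I\<close> and their cores \<open>J\<close>.\<close>
  have sum: "emeasure \<nu> (\<Union>i\<in>S. F i) = (\<Sum>i. if i \<in> S then emeasure \<nu> (F i) else 0)"
    if F: "\<And>i. F i \<subseteq> I i" "\<And>i. F i \<in> sets borel" for F
  proof -
    have "disjoint_family (\<lambda>i. if i \<in> S then F i else {})"
      using disjI F(1) unfolding disjoint_family_on_def by (auto split: if_splits) blast
    then have "(\<Sum>i. emeasure \<nu> (if i \<in> S then F i else {})) =
        emeasure \<nu> (\<Union>i. if i \<in> S then F i else {})"
      using F(2) sets by (intro suminf_emeasure) auto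
    moreover have "(\<Union>i. if i \<in> S then F i else {}) = (\<Union>i\<in>S. F i)" by auto
    moreover have "(\<lambda>i. emeasure \<nu> (if i \<in> S then F i else {})) =
        (\<lambda>i. if i \<in> S then emeasure \<nu> (F i) else 0)" by auto
    ultimately show ?thesis by simp
  qed
  have "ennreal \<theta> * emeasure \<nu> (\<Union>i\<in>S. I i) =
      (\<Sum>i. ennreal \<theta> * (if i \<in> S then emeasure \<nu> (I i) else 0))"
    by (subst sum) (auto simp: I_def)
  also have "\<dots> \<le> (\<Sum>i. if i \<in> S then emeasure \<nu> (J i) else 0)"
    using t(3) by (intro suminf_le) (auto simp: J_def)
  also have "\<dots> = emeasure \<nu> K"
    unfolding K_def using JI by (subst sum) (auto simp: J_def)
  finally show thesis
    using that[of K] \<open>closed K\<close> JI t(1) unfolding K_def I_def J_def by fastforce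
qed

section \<open>The retained fraction and the dyadic price bands\<close>

text \<open>Here \<alpha> and \<beta> stand for the odd and even revenue and \<gamma> for the extra
  gain of the even menu. If one of \<alpha>, \<beta> is larger, there is slack to lose a fraction of
  it; in a positive tie the slack comes from \<gamma>.\<close>

lemma half_sum_le_scaled:
  fixes \<alpha> \<beta> \<gamma> :: real
  assumes "0 \<le> \<alpha>" "0 \<le> \<beta>" "0 \<le> \<gamma>" "\<alpha> > 0 \<Longrightarrow> \<gamma> > 0"
  shows "\<exists>\<theta>. 0 \<le> \<theta> \<and> \<theta> < 1 \<and> ((\<alpha> + \<beta>) / 2 \<le> \<theta> * \<alpha> \<or> (\<alpha> + \<beta>) / 2 \<le> \<theta> * \<beta> + \<gamma>)"
proof -
  consider "\<alpha> > \<beta>" | "\<alpha> = 0" "\<beta> = 0" | "\<alpha> < \<beta>" | "\<alpha> = \<beta>" "\<beta> > 0" using assms by linarith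
  then show ?thesis
  proof cases
    case 1
    then show ?thesis using assms
      by (intro exI[of _ "(\<alpha> + \<beta>) / (2 * \<alpha>)"]) (auto simp: field_simps)
  next
    case 2
    then show ?thesis using assms by (intro exI[of _ 0]) auto
  next
    case 3
    then show ?thesis using assms
      by (intro exI[of _ "(\<alpha> + \<beta>) / (2 * \<beta>)"]) (auto simp: field_simps)
  next
    case 4
    then show ?thesis using assms
      \<comment> \<open>The loss \<beta> - \<theta> * \<beta> is then at most \<gamma>; the maximum
        with 0 covers \<gamma> > \<beta>.\<close>
      by (intro exI[of _ "max 0 (1 - \<gamma> / \<beta>)"]) (auto simp: max_def field_simps)
  qed
qed

lemma oddly_priced_undercut_menu:
  assumes "c_expensive c (undercut_menu u K)"
    and "K \<subseteq> (\<Union>i\<in>{i. odd i}. {c * 2 ^ i..<c * 2 ^ Suc i})"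
  shows "oddly_priced c (undercut_menu u K)"
  unfolding oddly_priced_def
proof (intro conjI ballI impI assms(1))
  fix x assume "x \<in> undercut_menu u K" "x \<noteq> null_option"
  then have "snd x \<in> K" by (rule undercut_menu_price)
  then obtain i where "odd i" "c * 2 ^ i \<le> snd x" "snd x < c * 2 ^ Suc i"
    using assms(2) by auto
  then show "\<exists>i::int. odd i \<and> c * 2 powr (real_of_int i) \<le> snd x \<and>
      snd x < c * 2 powr (real_of_int (i + 1))"
    by (intro exI[of _ "int i"]) (auto simp: powr_add powr_realpow mult.commute)
qed

lemma evenly_priced_undercut_menu:
  assumes "c_expensive c (undercut_menu u K)"
    and "K \<subseteq> (\<Union>i\<in>{i. even i}. {c * 2 ^ i..<c * 2 ^ Suc i})"
  shows "evenly_priced c (undercut_menu u K)"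
  unfolding evenly_priced_def
proof (intro conjI ballI impI assms(1))
  fix x assume "x \<in> undercut_menu u K" "x \<noteq> null_option"
  then have "snd x \<in> K" by (rule undercut_menu_price)
  then obtain i where "even i" "c * 2 ^ i \<le> snd x" "snd x < c * 2 ^ Suc i"
    using assms(2) by auto
  then show "\<exists>i::int. even i \<and> c * 2 powr (real_of_int i) \<le> snd x \<and>
      snd x < c * 2 powr (real_of_int (i + 1))"
    by (intro exI[of _ "int i"]) (auto simp: powr_add powr_realpow mult.commute)
qed

lemma atLeast_eq_UN_dyadic:
  fixes c :: real
  assumes "c > 0"
  shows "{c..} = (\<Union>i. {c * 2 ^ i..<c * 2 ^ Suc i})"
proof (intro set_eqI iffI)
  fix x assume "x \<in> {c..}"
  then have x: "c \<le> x" by simp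
  \<comment> \<open>Since \<open>c \<le> x\<close>, this least exponent is not 0, and its
    predecessor is the index of the band containing \<open>x\<close>.\<close>
  define n where "n = (LEAST n. x < c * 2 ^ n)"
  obtain m where "x / c < 2 ^ m" using real_arch_pow[of 2 "x / c"] by auto
  then have "x < c * 2 ^ m" using assms by (simp add: field_simps)
  then have n: "x < c * 2 ^ n" unfolding n_def by (rule LeastI)
  then obtain i where i: "n = Suc i" using x by (cases n) auto
  then have "\<not> x < c * 2 ^ i" using not_less_Least[of i "\<lambda>n. x < c * 2 ^ n"] n_def by simp
  then show "x \<in> (\<Union>i. {c * 2 ^ i..<c * 2 ^ Suc i})"
    using n i by (intro UN_I[of i]) auto
next
  fix x assume "x \<in> (\<Union>i. {c * 2 ^ i..<c * 2 ^ Suc i})"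
  then obtain i where "c * 2 ^ i \<le> x" by auto
  moreover have "c * 1 \<le> c * 2 ^ i" using assms by (intro mult_left_mono) auto
  ultimately show "x \<in> {c..}" by simp
qed

theorem claim4p4:
  fixes c :: real
    and M :: "'k::finite option_t set"
    and sel :: "real ^ 'k \<Rightarrow> 'k option_t"
    and D :: "(real ^ 'k) measure"
  assumes "c > 0"
    and "is_mechanism M" and "c_expensive c M" and "valid_selection M sel"
    and "prob_space D" and "sets D = sets borel"
    and "AE v in D. nonneg_vec v"
  shows "\<exists>M' sel'. is_mechanism M' \<and> c_expensive c M' \<and> valid_selection M' sel' \<and>
           (oddly_priced c M' \<or> evenly_priced c M') \<and>
           Rev D sel' \<ge> Rev D sel / 2"
proof -

  \<comment> \<open>The dominating menu and its price function\<close>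
  interpret prob_space D by fact
  have space: "space D = UNIV" using sets_eq_imp_space_eq[OF assms(6)] by simp
  have meas_D: "f \<in> borel_measurable D" if "f \<in> borel_measurable borel" for f :: "real ^ 'k \<Rightarrow> real"
    using that measurable_cong_sets[OF assms(6) refl] by blast
  define u where "u v = utility v (sel v)" for v
  have sel: "sel v \<in> M" "\<And>y. y \<in> M \<Longrightarrow> utility v y \<le> u v" if "nonneg_vec v" for v
    using assms(4) that by (auto simp: valid_selection_def u_def)
  have u_nonneg: "u v \<ge> 0" if "nonneg_vec v" for v
    using sel(2)[OF that, of null_option] assms(2) by (simp add: is_mechanism_def)
  have M_sub: "M \<subseteq> undercut_menu u {c..}"
    using assms(2,3) sel(2)
    by (auto simp: undercut_menu_def is_mechanism_def c_expensive_def mem_box_cart)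
  obtain s where s: "valid_selection (undercut_menu u {c..}) s"
    "\<And>v x. nonneg_vec v \<Longrightarrow> optimal_option (undercut_menu u {c..}) v x \<Longrightarrow> snd x \<le> snd (s v)"
    "\<And>v. snd (s v) \<ge> 0" "(\<lambda>v. snd (s v)) \<in> borel_measurable borel"
    by (rule undercut_menu_selection[OF closed_atLeast order_refl assms(1), of u]) blast
  define P where "P v = snd (s v)" for v
  have P_nonneg: "P v \<ge> 0" for v by (simp add: P_def s(3))
  have P_meas [measurable]: "P \<in> borel_measurable D"
    using meas_D[OF s(4)] by (simp add: P_def[abs_def])
  have s_in: "s v \<in> undercut_menu u {c..}" if "nonneg_vec v" for v
    using s(1) that by (simp add: valid_selection_def)
  \<comment> \<open>No added option exceeds \<open>u\<close>, and \<open>sel v\<close> attains it,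
    so the enlarged menu leaves the indirect utility unchanged. Hence \<open>sel v\<close> stays
    optimal there, and the tie rule yields \<open>sel_le\<close>.\<close>
  have s_util: "utility v (s v) = u v" if v: "nonneg_vec v" for v
  proof (rule antisym)
    show "utility v (s v) \<le> u v"
      using undercut_menu_utility_le[OF s_in[OF v] v u_nonneg[OF v]] .
    have "sel v \<in> undercut_menu u {c..}" using M_sub sel(1)[OF v] by blast
    then show "u v \<le> utility v (s v)"
      using s(1) v by (simp add: valid_selection_def u_def)
  qed
  have sel_le: "snd (sel v) \<le> P v" if v: "nonneg_vec v" for v
  proof -
    have "optimal_option (undercut_menu u {c..}) v (sel v)"
      using M_sub sel(1)[OF v] undercut_menu_utility_le[of _ u _ v, OF _ v u_nonneg[OF v]]
      unfolding optimal_option_def u_def[symmetric] by blast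
    then show ?thesis using s(2) v by (simp add: P_def)
  qed
  \<comment> \<open>The first bound keeps the revenue of buyers whose option survives. The second
    recovers at least \<open>c\<close> from buyers whose option was dropped, through its scaled
    copy.\<close>
  have priced_in: "\<exists>s'. is_mechanism (undercut_menu u K) \<and> c_expensive c (undercut_menu u K) \<and>
      valid_selection (undercut_menu u K) s' \<and>
      (\<forall>v. nonneg_vec v \<longrightarrow> P v \<in> K \<longrightarrow> P v \<le> snd (s' v)) \<and>
      (\<forall>v. nonneg_vec v \<longrightarrow> c \<in> K \<longrightarrow> P v \<ge> c \<longrightarrow> c \<le> snd (s' v))"
    if K: "closed K" "K \<subseteq> {c..}" for K
  proof -
    obtain s' where s': "is_mechanism (undercut_menu u K)" "c_expensive c (undercut_menu u K)"
      "valid_selection (undercut_menu u K) s'"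
      "\<And>v x. nonneg_vec v \<Longrightarrow> optimal_option (undercut_menu u K) v x \<Longrightarrow> snd x \<le> snd (s' v)"
      using undercut_menu_selection[OF K assms(1), of u] by metis
    have "P v \<le> snd (s' v)" if v: "nonneg_vec v" and PK: "P v \<in> K" for v
    proof -
      \<comment> \<open>The option \<open>s v\<close> survives the change of price set and attains
        the ceiling \<open>u v\<close>, so it is optimal in the restricted menu.\<close>
      have "s v \<in> undercut_menu u K"
        using undercut_menu_change_price_set[OF s_in[OF v]] PK by (simp add: P_def)
      then have "optimal_option (undercut_menu u K) v (s v)"
        using undercut_menu_utility_le[of _ u _ v, OF _ v u_nonneg[OF v]]
        by (simp add: optimal_option_def s_util[OF v])
      then show ?thesis using s'(4)[OF v] by (simp add: P_def)
    qed
    moreover have "c \<le> snd (s' v)" if v: "nonneg_vec v" and cK: "c \<in> K" and Pc: "c \<le> P v" for v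
    proof -
      \<comment> \<open>Scaling to price \<open>c\<close> multiplies the utility by
        \<open>c / P v\<close>, which keeps it nonnegative.\<close>
      define x where "x = (c / P v) *\<^sub>R s v"
      have price_x: "snd x = c" using Pc assms(1) by (simp add: x_def P_def)
      have "x \<in> undercut_menu u K"
        unfolding x_def using Pc assms(1) cK
        by (intro undercut_menu_scale[OF s_in[OF v] _ _ u_nonneg]) (auto simp: P_def)
      moreover have "utility v x \<ge> 0"
        using u_nonneg[OF v] s_util[OF v] P_nonneg[of v] assms(1)
        by (simp add: x_def utility_scaleR)
      moreover have sv: "s' v \<in> undercut_menu u K"
          "\<And>y. y \<in> undercut_menu u K \<Longrightarrow> utility v y \<le> utility v (s' v)"
        using s'(3) v by (auto simp: valid_selection_def)
      \<comment> \<open>If the null option were selected, the maximal utility would be 0 and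
        \<open>x\<close> would tie with it; the tie rule would then demand a price of at least
        \<open>c > 0\<close>.\<close>
      ultimately have "optimal_option (undercut_menu u K) v x" if "s' v = null_option"
        using that unfolding optimal_option_def by (metis order_trans utility_null_option)
      then have "s' v \<noteq> null_option"
        using s'(4)[OF v, of x] price_x assms(1) by (metis not_le snd_null_option)
      then show ?thesis using s'(2) sv(1) by (simp add: c_expensive_def)
    qed
    ultimately show ?thesis using s' by blast
  qed

  \<comment> \<open>Price bands and the revenue measure on prices\<close>
  define E where "E S = (\<Union>i\<in>S. {c * 2 ^ i..<c * 2 ^ Suc i})" for S
  have E_borel [measurable]: "E S \<in> sets borel" for S
    unfolding E_def by (intro sets.countable_UN'') auto
  have E_UNIV: "E UNIV = {c..}" using atLeast_eq_UN_dyadic[OF assms(1)] by (simp add: E_def)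
  have E_sub: "E S \<subseteq> {c..}" for S unfolding E_UNIV[symmetric] E_def by auto
  have E_cover: "E {i. odd i} \<union> E {i. even i} = {c..}"
    unfolding E_UNIV[symmetric] E_def by auto
  have a_mono: "strict_mono (\<lambda>i. c * 2 ^ i)"
    using assms(1) by (intro strict_mono_Suc_iff[THEN iffD2]) auto
  have a_lim: "filterlim (\<lambda>i. c * 2 ^ i) at_top sequentially"
    using assms(1) by (intro filterlim_tendsto_pos_mult_at_top[OF tendsto_const]
        filterlim_at_infinity_imp_filterlim_at_top filterlim_realpow_sequentially_gt1) auto
  have E_disj: "E {i. odd i} \<inter> E {i. even i} = {}"
  proof -
    have "i = j" if "c * 2 ^ i \<le> x" "x < c * 2 ^ Suc i" "c * 2 ^ j \<le> x" "x < c * 2 ^ Suc j" for i j x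
    proof -
      have "c * 2 ^ i < c * 2 ^ Suc j" "c * 2 ^ j < c * 2 ^ Suc i" using that by linarith+
      then have "i < Suc j" "j < Suc i" using assms(1) by (simp_all del: power_Suc)
      then show "i = j" by simp
    qed
    then show ?thesis unfolding E_def by (auto simp del: power_Suc) metis
  qed

  \<comment> \<open>Revenue as a measure on the price line: a price set receives the payments under
    \<open>s\<close> of the buyers whose price lies in it.\<close>
  define \<nu> where "\<nu> = distr (density D (\<lambda>v. ennreal (P v))) borel P"
  have \<nu>_eq: "emeasure \<nu> K = (\<integral>\<^sup>+v. ennreal (P v) * indicator (P -` K) v \<partial>D)"
    if [measurable]: "K \<in> sets borel" for K
  proof -
    have "P -` K \<in> sets D" using measurable_sets[OF P_meas that] by (simp add: space)
    then show ?thesis unfolding \<nu>_def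
      by (simp add: emeasure_distr emeasure_density space)
  qed
  have core: "\<exists>K. closed K \<and> K \<subseteq> E S \<and> (\<forall>i\<in>S. c * 2 ^ i \<in> K) \<and>
      ennreal \<theta> * emeasure \<nu> (E S) \<le> emeasure \<nu> K" if \<theta>: "0 \<le> \<theta>" "\<theta> < 1" for S \<theta>
  proof (rule closed_core_of_intervals[OF _ a_mono a_lim _ \<theta>, of \<nu> S])
    show "sets \<nu> = sets borel" by (simp add: \<nu>_def)
    show "emeasure \<nu> {c * 2 ^ i..<c * 2 ^ Suc i} < \<infinity>" for i
    proof -
      \<comment> \<open>Payments in one band are bounded by its upper end and \<open>D\<close> has
        mass 1, so each band has finite mass even when the total revenue is infinite.\<close>
      have "emeasure \<nu> {c * 2 ^ i..<c * 2 ^ Suc i} \<le> (\<integral>\<^sup>+v. ennreal (c * 2 ^ Suc i) \<partial>D)"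
        by (subst \<nu>_eq, simp, rule nn_integral_mono) (auto intro!: ennreal_leI split: split_indicator)
      also have "\<dots> < \<infinity>" by (simp add: emeasure_space_1)
      finally show ?thesis .
    qed
  qed (auto simp: E_def image_subset_iff)

  define \<pi> where "\<pi> = emeasure D (P -` E {i. odd i})"
  have odd_sets: "P -` E {i. odd i} \<in> sets D"
    using measurable_sets[OF P_meas E_borel] by (simp add: space)

  \<comment> \<open>Sufficient conditions for the odd and the even menu\<close>
  have goal_odd: ?thesis
    if \<theta>: "0 \<le> \<theta>" "\<theta> < 1" and R: "Rev D sel / 2 \<le> ennreal \<theta> * emeasure \<nu> (E {i. odd i})" for \<theta>
  proof -
    obtain K where K: "closed K" "K \<subseteq> E {i. odd i}" and
        nuK: "ennreal \<theta> * emeasure \<nu> (E {i. odd i}) \<le> emeasure \<nu> K"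
      using core[OF \<theta>] by blast
    obtain s' where s': "is_mechanism (undercut_menu u K)" "c_expensive c (undercut_menu u K)"
      "valid_selection (undercut_menu u K) s'"
      "\<And>v. nonneg_vec v \<Longrightarrow> P v \<in> K \<Longrightarrow> P v \<le> snd (s' v)"
      using priced_in[OF K(1)] K(2) E_sub by (metis order_trans)
    have "emeasure \<nu> K \<le> Rev D s'"
      unfolding Rev_def \<nu>_eq[OF borel_closed[OF K(1)]]
    proof (rule nn_integral_mono_AE, use assms(7) in eventually_elim)
      case (elim v)
      then show ?case using s'(4)[OF elim] by (auto simp: ennreal_leI split: split_indicator)
    qed
    then have "Rev D sel / 2 \<le> Rev D s'" using R nuK by (meson order_trans)
    moreover have "oddly_priced c (undercut_menu u K)"
      using oddly_priced_undercut_menu s'(2) K(2) by (simp add: E_def)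
    ultimately show ?thesis using s' by blast
  qed
  have goal_even: ?thesis
    if \<theta>: "0 \<le> \<theta>" "\<theta> < 1"
      and R: "Rev D sel / 2 \<le> ennreal \<theta> * emeasure \<nu> (E {i. even i}) + ennreal c * \<pi>" for \<theta>
  proof -
    obtain K where K: "closed K" "K \<subseteq> E {i. even i}" "c * 2 ^ 0 \<in> K" and
        nuK: "ennreal \<theta> * emeasure \<nu> (E {i. even i}) \<le> emeasure \<nu> K"
      using core[OF \<theta>, of "{i. even i}"] even_zero by blast
    \<comment> \<open>The left endpoint of band 0 is \<open>c\<close>, and 0 is even; this is why
      the extra gain is available on the even side.\<close>
    have cK: "c \<in> K" using K(3) by simp
    obtain s' where s': "is_mechanism (undercut_menu u K)" "c_expensive c (undercut_menu u K)"
      "valid_selection (undercut_menu u K) s'"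
      "\<And>v. nonneg_vec v \<Longrightarrow> P v \<in> K \<Longrightarrow> P v \<le> snd (s' v)"
      "\<And>v. nonneg_vec v \<Longrightarrow> c \<in> K \<Longrightarrow> P v \<ge> c \<Longrightarrow> c \<le> snd (s' v)"
      using priced_in[OF K(1)] K(2) E_sub by (metis order_trans)
    have K_sets: "P -` K \<in> sets D"
      using measurable_sets[OF P_meas borel_closed[OF K(1)]] by (simp add: space)
    have "emeasure \<nu> K + ennreal c * \<pi> =
        (\<integral>\<^sup>+v. ennreal (P v) * indicator (P -` K) v + ennreal c * indicator (P -` E {i. odd i}) v \<partial>D)"
      unfolding \<pi>_def \<nu>_eq[OF borel_closed[OF K(1)]] using odd_sets K_sets
      by (subst nn_integral_add) (auto simp: nn_integral_cmult_indicator)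
    also have "\<dots> \<le> Rev D s'"
      unfolding Rev_def
    proof (rule nn_integral_mono_AE, use assms(7) in eventually_elim)
      case (elim v)
      \<comment> \<open>\<open>K\<close> contains only prices of even bands, so at most one of the
        two summands is nonzero at any \<open>v\<close>.\<close>
      consider "P v \<in> K" "P v \<notin> E {i. odd i}" | "P v \<notin> K" "P v \<in> E {i. odd i}"
        | "P v \<notin> K" "P v \<notin> E {i. odd i}" using K(2) E_disj by blast
      then show ?case
      proof cases
        case 2
        then have "c \<le> P v" using E_sub by auto
        then show ?thesis using 2 s'(5)[OF elim cK] by (auto simp: ennreal_leI)
      qed (use s'(4)[OF elim] in \<open>auto simp: ennreal_leI\<close>)
    qed
    finally have "emeasure \<nu> K + ennreal c * \<pi> \<le> Rev D s'" .
    then have "Rev D sel / 2 \<le> Rev D s'"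
      using R add_right_mono[OF nuK, of "ennreal c * \<pi>"] by (meson order_trans)
    moreover have "evenly_priced c (undercut_menu u K)"
      using evenly_priced_undercut_menu s'(2) K(2) by (simp add: E_def)
    ultimately show ?thesis using s' by blast
  qed

  \<comment> \<open>Comparing the revenues of the two parities\<close>
  define A where "A = emeasure \<nu> (E {i. odd i})"
  define B where "B = emeasure \<nu> (E {i. even i})"
  have Rev_le: "Rev D sel \<le> A + B"
  proof -
    \<comment> \<open>The integral \<open>nn_integral\<close> is monotone without measurability, so
      the pointwise bound \<open>sel_le\<close> suffices. Restricting to \<open>{c..}\<close> loses
      nothing, as a nonzero \<open>P v\<close> is the price of a non-null option.\<close>
    have "Rev D sel \<le> (\<integral>\<^sup>+v. ennreal (P v) * indicator (P -` {c..}) v \<partial>D)"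
      unfolding Rev_def
    proof (rule nn_integral_mono_AE, use assms(7) in eventually_elim)
      case (elim v)
      have "P v \<in> {c..}" if "P v \<noteq> 0"
        using undercut_menu_price[OF s_in[OF elim]] that unfolding P_def by fastforce
      then show ?case using sel_le[OF elim] by (cases "P v = 0") (auto simp: ennreal_leI ennreal_neg)
    qed
    also have "\<dots> = emeasure \<nu> (E {i. odd i} \<union> E {i. even i})"
      by (simp add: \<nu>_eq E_cover)
    also have "\<dots> = A + B"
      unfolding A_def B_def by (subst plus_emeasure) (auto simp: E_disj \<nu>_def)
    finally show ?thesis .
  qed
  have \<pi>_pos: "\<pi> \<noteq> 0" if "A \<noteq> 0"
  proof
    assume "\<pi> = 0"
    then have "P -` E {i. odd i} \<in> null_sets D" using odd_sets by (auto simp: \<pi>_def)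
    then have "A = 0" by (simp add: A_def \<nu>_eq nn_integral_null_set)
    with that show False by simp
  qed
  \<comment> \<open>If one parity has infinite revenue, any positive fraction of it is infinite, so
    \<theta> = 1/2 will do.\<close>
  consider "A = \<infinity>" | "B = \<infinity>" | "A \<noteq> \<infinity>" "B \<noteq> \<infinity>" by blast
  then show ?thesis
  proof cases
    case 1
    then show ?thesis using goal_odd[of "1/2"] by (simp add: A_def ennreal_mult_top)
  next
    case 2
    then show ?thesis using goal_even[of "1/2"] by (simp add: B_def ennreal_mult_top)
  next
    case 3
    then obtain \<alpha> \<beta> where ab: "A = ennreal \<alpha>" "\<alpha> \<ge> 0" "B = ennreal \<beta>" "\<beta> \<ge> 0"
      by (metis ennreal_cases infinity_ennreal_def)
    \<comment> \<open>The guaranteed gain of the even menu: price \<open>c\<close> from every buyer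
      with an odd-band price. It is positive whenever the odd revenue is.\<close>
    define \<gamma> where "\<gamma> = c * prob (P -` E {i. odd i})"
    have \<gamma>: "ennreal c * \<pi> = ennreal \<gamma>" "\<gamma> \<ge> 0"
      using assms(1) by (auto simp: \<gamma>_def \<pi>_def emeasure_eq_measure ennreal_mult)
    have \<gamma>_pos: "\<gamma> > 0" if "\<alpha> > 0"
      using \<pi>_pos that ab(1) assms(1)
      by (auto simp: \<gamma>_def \<pi>_def emeasure_eq_measure zero_less_measure_iff)
    have half: "Rev D sel / 2 \<le> ennreal ((\<alpha> + \<beta>) / 2)"
      using divide_right_mono_ennreal[OF Rev_le, of 2] ab
      by (simp add: ennreal_plus[symmetric] divide_ennreal[symmetric] del: ennreal_plus)
    obtain \<theta> where \<theta>: "0 \<le> \<theta>" "\<theta> < 1"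
        "(\<alpha> + \<beta>) / 2 \<le> \<theta> * \<alpha> \<or> (\<alpha> + \<beta>) / 2 \<le> \<theta> * \<beta> + \<gamma>"
      using half_sum_le_scaled[OF ab(2,4) \<gamma>(2) \<gamma>_pos] by blast
    from \<theta>(3) show ?thesis
    proof
      assume "(\<alpha> + \<beta>) / 2 \<le> \<theta> * \<alpha>"
      then have "Rev D sel / 2 \<le> ennreal \<theta> * A"
        using half ab \<theta>(1) by (metis ennreal_leI ennreal_mult order_trans)
      then show ?thesis using goal_odd \<theta> by (simp add: A_def)
    next
      assume "(\<alpha> + \<beta>) / 2 \<le> \<theta> * \<beta> + \<gamma>"
      then have "Rev D sel / 2 \<le> ennreal (\<theta> * \<beta> + \<gamma>)"
        using half by (meson ennreal_leI order_trans)
      also have "\<dots> = ennreal \<theta> * B + ennreal c * \<pi>"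
        using ab \<theta>(1) \<gamma> by (simp add: ennreal_mult)
      finally show ?thesis using goal_even \<theta> by (simp add: B_def)
    qed
  qed
qed

end
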